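(* Every parallel poly-pushdown ($\mathcal P$) group has solvable word problem.
   Context: **Languages.** For a finite alphabet $A$, $A^*$ is the free monoid on $A$ (words), $\epsilon$ is the empty word, and a language is a subset of $A^*$. **Deterministic pushdown automata.** A deterministic pushdown automaton is a 7-tuple $M=(S,A,B,\tau,s_0,Z_0,Y)$ with $S$ a finite set of states, $A$ a finite input alphabet, $B$ a finite stack alphabet, $s_0\in S$ the start state, $Z_0\in B$ the start symbol, $Y\subseteq S$ the final states, and $\tau:\Sigma\to S\times B^*$ a map with $\Sigma\subseteq (A\cup\{\epsilon\})\times B\times S$ such that for every $(b,s)\in B\times S$ either $(\epsilon,b,s)\in\Sigma$ and $(a,b,s)\notin\Sigma$ for all $a\in A$, or $(\epsilon,b,s)\notin\Sigma$ and $(a,b,s)\in\Sigma$ for all $a\in A$. An instantaneous description is a triple $(u,z,s)\in A^*\times B^*\times S$ (unread input, stack with top at the right end, state). $M$ makes the transition $(av,yb,s)\to(v,y\alpha,t)$ if $a\in A\cup\{\epsilon\}$, $b\in B$, $(a,b,s)\in \Sigma$ and $\tau(a,b,s)=(t,\alpha)$; $\to^*$ is the reflexive transitive closure. $M$ accepts $w$ by final state if $(w,Z_0,s_0)\to^*(\epsilon,z,s)$ for some $z\in B^*$, $s\in Y$; it accepts $w$ by empty stack if $(w,Z_0,s_0)\to^*(\epsilon,\epsilon,s)$ for some $s\in S$. A language is the language of a deterministic pushdown automaton if it is the set of words accepted by some such $M$ in either one of these two modes. **$\mathcal P$ languages.** $L\subseteq A^*$ is parallel poly-pushdown ($\mathcal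 P$) if it is an intersection of finitely many languages over $A$ of deterministic pushdown automata. **Two-tape version.** Let $\$$ be a symbol not in $A$, and let $(A\cup\{\$\})^\sharp$, $(A\cup\{\$\})^\flat$ be two disjoint copies of $A\cup\{\$\}$, with induced maps on words $u\mapsto u^\sharp$, $v\mapsto v^\flat$. A shuffle $\sigma(u,v)$ of words $u,v$ is a word $u_1^\sharp v_1^\flat\cdots u_k^\sharp v_k^\flat$ with $u=u_1\cdots u_k$, $v=v_1\cdots v_k$, $u_i\ne\epsilon$ for $i>1$, $v_j\neq\epsilon$ for $j<k$. An asynchronous two-tape pushdown automaton over $A$ is a deterministic pushdown automaton $T$ with input alphabet $(A\cup\{\$\})^\sharp\sqcup (A\cup\{\$\})^\flat$ whose states are partitioned into two sets $S_\sharp,S_\flat$. A pair $(u,v)\in A^*\times A^*$ is accepted by $T$ if some shuffle $\sigma(u\$,v\$)$ is accepted by $T$ and, while reading it, $T$ reads letters of $(A\cup\{\$\})^\sharp$ only in states of $S_\sharp$ and letters of $(A\cup\{\$\})^\flat$ only in states of $S_\flat$. The language of $T$ is the set of accepted pairs. A subset of $A^*\times A^*$ is AT$\mathcal P$ (asynchronous two-tape parallel poly-pushdown) if it is the intersection of the languages of finitely many asynchronous two-tape pushdown automata over $A$. **$\mathcal P$ groups.** Let $G$ be a group and $A$ a finite set with a map $A\to G$ such that the induced monoid homomorphism $A^*\to G$, $w\mapsto\overline w$, is surjective. A language $L\subseteq A^*$ is a parallel poly-pushdown structure for $G$ if (1) $w\mapsto \overline w$ restricts to a bijection $L\to G$;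 (2) $L$ is $\mathcal P$; (3) for each $a\in A$ the set $\{(w,w')\in L\times L: \overline{w'}=\overline{wa}\}$ is AT$\mathcal P$. $G$ is parallel poly-pushdown (a $\mathcal P$ group) if it has such a structure for some such $A$. *)

theory Defs
  imports "HOL-Algebra.Group" "HOL-Library.Nat_Bijection"
begin

section \<open>Deterministic pushdown automata\<close>

(* In the domain of dpda_trans, None as first component stands for the empty word. *)
record ('a, 'b, 's) dpda =
  dpda_states :: "'s set"
  dpda_inputs :: "'a set"
  dpda_stack :: "'b set"
  dpda_trans :: "'a option \<times> 'b \<times> 's \<Rightarrow> ('s \<times> 'b list) option"
  dpda_start :: "'s"
  dpda_bottom :: "'b"
  dpda_finals :: "'s set"

definition dpda :: "('a, 'b, 's) dpda \<Rightarrow> bool" where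
  "dpda M \<longleftrightarrow>
     finite (dpda_states M) \<and> finite (dpda_inputs M) \<and> finite (dpda_stack M) \<and>
     dpda_start M \<in> dpda_states M \<and> dpda_bottom M \<in> dpda_stack M \<and>
     dpda_finals M \<subseteq> dpda_states M \<and>
     dom (dpda_trans M) \<subseteq>
       insert None (Some ` dpda_inputs M) \<times> dpda_stack M \<times> dpda_states M \<and>
     ran (dpda_trans M) \<subseteq> dpda_states M \<times> lists (dpda_stack M) \<and>
     (\<forall>b \<in> dpda_stack M. \<forall>s \<in> dpda_states M.
        ((None, b, s) \<in> dom (dpda_trans M) \<and>
           (\<forall>a \<in> dpda_inputs M. (Some a, b, s) \<notin> dom (dpda_trans M))) \<or>
        ((None, b, s) \<notin> dom (dpda_trans M) \<and>
           (\<forall>a \<in> dpda_inputs M. (Some a, b, s) \<in> dom (dpda_trans M))))"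

(* Unread input, stack (its top is the last element of the list), state. *)
type_synonym ('a, 'b, 's) config = "'a list \<times> 'b list \<times> 's"

(* The second argument records the letter read by the transition, if any. *)
inductive dpda_move ::
  "('a, 'b, 's) dpda \<Rightarrow> 'a option \<Rightarrow> ('a, 'b, 's) config \<Rightarrow> ('a, 'b, 's) config \<Rightarrow> bool"
  for M where
  move_eps: "dpda_trans M (None, b, s) = Some (t, \<alpha>) \<Longrightarrow>
    dpda_move M None (v, y @ [b], s) (v, y @ \<alpha>, t)"
| move_read: "dpda_trans M (Some a, b, s) = Some (t, \<alpha>) \<Longrightarrow>
    dpda_move M (Some a) (a # v, y @ [b], s) (v, y @ \<alpha>, t)"

definition dpda_step ::
  "('a, 'b, 's) dpda \<Rightarrow> ('a, 'b, 's) config \<Rightarrow> ('a, 'b, 's) config \<Rightarrow> bool" where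
  "dpda_step M c c' \<longleftrightarrow> (\<exists>x. dpda_move M x c c')"

definition dpda_init :: "('a, 'b, 's) dpda \<Rightarrow> 'a list \<Rightarrow> ('a, 'b, 's) config" where
  "dpda_init M w = (w, [dpda_bottom M], dpda_start M)"

datatype acceptance = Final_State | Empty_Stack

fun dpda_accepting :: "('a, 'b, 's) dpda \<Rightarrow> acceptance \<Rightarrow> ('a, 'b, 's) config \<Rightarrow> bool" where
  "dpda_accepting M Final_State (u, z, s) \<longleftrightarrow> u = [] \<and> s \<in> dpda_finals M"
| "dpda_accepting M Empty_Stack (u, z, s) \<longleftrightarrow> u = [] \<and> z = [] \<and> s \<in> dpda_states M"

definition dpda_lang :: "('a, 'b, 's) dpda \<Rightarrow> acceptance \<Rightarrow> 'a list set" where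
  "dpda_lang M m =
     {w \<in> lists (dpda_inputs M).
        \<exists>c. (dpda_step M)\<^sup>*\<^sup>* (dpda_init M w) c \<and> dpda_accepting M m c}"

(* Up to renaming, every finite set of states or of stack symbols is a set of natural numbers. *)
definition dpda_language :: "'a set \<Rightarrow> 'a list set \<Rightarrow> bool" where
  "dpda_language A L \<longleftrightarrow>
     (\<exists>(M :: ('a, nat, nat) dpda) m. dpda M \<and> dpda_inputs M = A \<and> L = dpda_lang M m)"

(* The empty intersection is the set of all words; the latter is itself a DPDA language. *)
definition P_language :: "'a set \<Rightarrow> 'a list set \<Rightarrow> bool" where
  "P_language A L \<longleftrightarrow>
     (\<exists>F. finite F \<and> (\<forall>K \<in> F. dpda_language A K) \<and> L = lists A \<inter> \<Inter>F)"


section \<open>Asynchronous two-tape pushdown automata\<close>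

(* None is the end marker $; Inl and Inr produce the sharp and the flat copy. *)
type_synonym 'a tape_letter = "'a option + 'a option"

definition tape_alphabet :: "'a set \<Rightarrow> 'a tape_letter set" where
  "tape_alphabet A = insert None (Some ` A) <+> insert None (Some ` A)"

definition end_marked :: "'a list \<Rightarrow> 'a option list" where
  "end_marked u = map Some u @ [None]"

definition is_shuffle :: "'c list \<Rightarrow> 'c list \<Rightarrow> ('c + 'c) list \<Rightarrow> bool" where
  "is_shuffle u v w \<longleftrightarrow>
     (\<exists>us vs. length us = length vs \<and> concat us = u \<and> concat vs = v \<and>
        (\<forall>i. 0 < i \<and> i < length us \<longrightarrow> us ! i \<noteq> []) \<and>
        (\<forall>j. Suc j < length vs \<longrightarrow> vs ! j \<noteq> []) \<and>
        w = concat (map2 (\<lambda>x y. map Inl x @ map Inr y) us vs))"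

definition two_tape :: "'a set \<Rightarrow> ('a tape_letter, 'b, 's) dpda \<Rightarrow> 's set \<Rightarrow> 's set \<Rightarrow> bool" where
  "two_tape A T Sh Fl \<longleftrightarrow>
     dpda T \<and> dpda_inputs T = tape_alphabet A \<and>
     Sh \<union> Fl = dpda_states T \<and> Sh \<inter> Fl = {}"

fun may_read :: "'s set \<Rightarrow> 's set \<Rightarrow> 'a tape_letter option \<Rightarrow> 's \<Rightarrow> bool" where
  "may_read Sh Fl None s \<longleftrightarrow> True"
| "may_read Sh Fl (Some (Inl x)) s \<longleftrightarrow> s \<in> Sh"
| "may_read Sh Fl (Some (Inr x)) s \<longleftrightarrow> s \<in> Fl"

definition tape_step :: "('a tape_letter, 'b, 's) dpda \<Rightarrow> 's set \<Rightarrow> 's set \<Rightarrow>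
    ('a tape_letter, 'b, 's) config \<Rightarrow> ('a tape_letter, 'b, 's) config \<Rightarrow> bool" where
  "tape_step T Sh Fl c c' \<longleftrightarrow>
     (\<exists>x. dpda_move T x c c' \<and> may_read Sh Fl x (snd (snd c)))"

definition two_tape_lang ::
  "'a set \<Rightarrow> ('a tape_letter, 'b, 's) dpda \<Rightarrow> 's set \<Rightarrow> 's set \<Rightarrow> acceptance \<Rightarrow>
     ('a list \<times> 'a list) set" where
  "two_tape_lang A T Sh Fl m =
     {(u, v). u \<in> lists A \<and> v \<in> lists A \<and>
        (\<exists>w c. is_shuffle (end_marked u) (end_marked v) w \<and>
           (tape_step T Sh Fl)\<^sup>*\<^sup>* (dpda_init T w) c \<and> dpda_accepting T m c)}"

definition two_tape_language :: "'a set \<Rightarrow> ('a list \<times> 'a list) set \<Rightarrow> bool" where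
  "two_tape_language A R \<longleftrightarrow>
     (\<exists>(T :: ('a tape_letter, nat, nat) dpda) Sh Fl m.
        two_tape A T Sh Fl \<and> R = two_tape_lang A T Sh Fl m)"

definition ATP_language :: "'a set \<Rightarrow> ('a list \<times> 'a list) set \<Rightarrow> bool" where
  "ATP_language A R \<longleftrightarrow>
     (\<exists>F. finite F \<and> (\<forall>K \<in> F. two_tape_language A K) \<and> R = (lists A \<times> lists A) \<inter> \<Inter>F)"


section \<open>Parallel poly-pushdown groups\<close>

definition word_eval :: "('g, 'm) monoid_scheme \<Rightarrow> ('a \<Rightarrow> 'g) \<Rightarrow> 'a list \<Rightarrow> 'g" where
  "word_eval G \<pi> w = foldr (\<lambda>a x. \<pi> a \<otimes>\<^bsub>G\<^esub> x) w \<one>\<^bsub>G\<^esub>"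

definition generating_alphabet :: "('g, 'm) monoid_scheme \<Rightarrow> 'a set \<Rightarrow> ('a \<Rightarrow> 'g) \<Rightarrow> bool" where
  "generating_alphabet G A \<pi> \<longleftrightarrow>
     finite A \<and> \<pi> \<in> A \<rightarrow> carrier G \<and> word_eval G \<pi> ` lists A = carrier G"

definition P_structure ::
  "('g, 'm) monoid_scheme \<Rightarrow> 'a set \<Rightarrow> ('a \<Rightarrow> 'g) \<Rightarrow> 'a list set \<Rightarrow> bool" where
  "P_structure G A \<pi> L \<longleftrightarrow>
     L \<subseteq> lists A \<and> bij_betw (word_eval G \<pi>) L (carrier G) \<and>
     P_language A L \<and>
     (\<forall>a \<in> A. ATP_language A
        {(w, w'). w \<in> L \<and> w' \<in> L \<and> word_eval G \<pi> w' = word_eval G \<pi> (w @ [a])})"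

(* Up to renaming, every finite alphabet is a set of natural numbers. *)
definition P_group :: "('g, 'm) monoid_scheme \<Rightarrow> bool" where
  "P_group G \<longleftrightarrow> group G \<and>
     (\<exists>(A :: nat set) \<pi> L. generating_alphabet G A \<pi> \<and> P_structure G A \<pi> L)"


section \<open>Decidability and the word problem\<close>

datatype recf = Zero | Successor | Proj nat | Comp recf "recf list" | Prim recf recf | Mu recf

(* computes f xs y: the partial recursive function denoted by f is defined at xs with value y. *)
inductive computes :: "recf \<Rightarrow> nat list \<Rightarrow> nat \<Rightarrow> bool" where
  zero: "computes Zero xs 0"
| succ: "computes Successor [x] (Suc x)"
| proj: "i < length xs \<Longrightarrow> computes (Proj i) xs (xs ! i)"
| comp: "list_all2 (\<lambda>g y. computes g xs y) gs ys \<Longrightarrow> computes f ys z \<Longrightarrow>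
    computes (Comp f gs) xs z"
| prim_0: "computes f xs y \<Longrightarrow> computes (Prim f g) (0 # xs) y"
| prim_Suc: "computes (Prim f g) (n # xs) r \<Longrightarrow> computes g (n # r # xs) y \<Longrightarrow>
    computes (Prim f g) (Suc n # xs) y"
| mu: "computes f (n # xs) 0 \<Longrightarrow> (\<And>k. k < n \<Longrightarrow> \<exists>y. computes f (k # xs) (Suc y)) \<Longrightarrow>
    computes (Mu f) xs n"
  monos list_all2_mono

lemma computes_functional: "computes f xs y \<Longrightarrow> computes f xs z \<Longrightarrow> y = z"
proof (induction arbitrary: z rule: computes.induct)
  case (comp xs gs ys f v)
  from comp.prems obtain ys' where
    1: "list_all2 (\<lambda>g y. computes g xs y) gs ys'" and 2: "computes f ys' z"
    by (cases rule: computes.cases) auto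
  have "ys = ys'"
    using comp.IH(1) 1 unfolding list_all2_conv_all_nth by (metis nth_equalityI)
  then show ?case using 2 comp.IH(2) by blast
next
  case (mu f n xs)
  from mu.prems have 1: "computes f (z # xs) 0"
    and 2: "\<And>k. k < z \<Longrightarrow> \<exists>y. computes f (k # xs) (Suc y)"
    by (cases rule: computes.cases, blast)+
  show ?case
  proof (cases n z rule: linorder_cases)
    case less
    then obtain y where "computes f (n # xs) (Suc y)" using 2 by blast
    then show ?thesis using mu.IH(1) by blast
  next
    case greater
    then show ?thesis using 1 mu.IH(2) by blast
  qed
next
  case (prim_Suc f g n xs r y)
  from prim_Suc.prems obtain r' where "computes (Prim f g) (n # xs) r'" "computes g (n # r' # xs) z"
    by (cases rule: computes.cases) auto
  then show ?case using prim_Suc.IH by blast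
next
  case zero
  then show ?case by (cases rule: computes.cases) simp_all
next
  case succ
  then show ?case by (cases rule: computes.cases) simp_all
next
  case proj
  from proj.prems show ?case by (cases rule: computes.cases) simp_all
next
  case (prim_0 f xs y g)
  from prim_0.prems have "computes f xs z" by (cases rule: computes.cases)
  then show ?case by (rule prim_0.IH)
qed

definition decidable_set :: "nat set \<Rightarrow> bool" where
  "decidable_set D \<longleftrightarrow> (\<exists>f. \<forall>n. computes f [n] (if n \<in> D then 1 else 0))"

definition word_problem :: "('g, 'm) monoid_scheme \<Rightarrow> 'a set \<Rightarrow> ('a \<Rightarrow> 'g) \<Rightarrow> 'a list set" where
  "word_problem G A \<pi> = {w \<in> lists A. word_eval G \<pi> w = \<one>\<^bsub>G\<^esub>}"

(* G is finitely generated, and its word problem is decidable with respect to every finite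
   alphabet generating G as a monoid. A finite set X of group generators is covered by the
   alphabet consisting of X and formal inverses of its elements. *)
definition solvable_word_problem :: "('g, 'm) monoid_scheme \<Rightarrow> bool" where
  "solvable_word_problem G \<longleftrightarrow>
     (\<exists>(A :: nat set) \<pi>. generating_alphabet G A \<pi>) \<and>
     (\<forall>(A :: nat set) \<pi>. generating_alphabet G A \<pi> \<longrightarrow>
        decidable_set (list_encode ` word_problem G A \<pi>))"

end

theory Submission
  imports Defs
begin

text \<open>
  The algorithm is a search. Fix a structure over an alphabet \<open>A\<close> with set \<open>L\<close> of normal
  forms. The run of an automaton is a finite object whose correctness can be checked, so each
  relation ``\<open>u, u' \<in> L\<close> and \<open>u'\<close> represents \<open>u a\<close>'' is semidecidable
  (\<open>semidec_rel_ATP_language\<close>): guess the order in which the two tapes are read, together with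
  the transitions of each of the finitely many automata. A letter \<open>b\<close> of another generating
  alphabet equals a word over \<open>A\<close>, so right multiplication by \<open>b\<close> is a composition of
  such relations and hence semidecidable on normal forms as well (\<open>semidec_rel_follow\<close>,
  \<open>follow_iff\<close>).

  Let \<open>e\<close> be the normal form of the identity. Reading an input word from left to right while
  updating the normal form, starting from \<open>e\<close>, leads to exactly one normal form for every
  prefix over the alphabet. The word is trivial iff the search can consume it completely and arrive
  at \<open>e\<close>; it is nontrivial or contains a foreign letter iff the search can end in
  another normal form or meet a foreign letter. Both conditions are semidecidable, so the word problem
  is decidable (\<open>decidable_set_if_semidec\<close>). The constants involved, such as \<open>e\<close> and
  the words for the letters \<open>b\<close>, only have to exist.

  Everything is coded by single natural numbers. A predicate is semidecidable if it asks for a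
  certificate on which a computable function vanishes. The key closure property is that
  under reflexive transitive closure (\<open>semidec2_rtranclp\<close>): each of the searches above is the
  closure of a simple step relation.
\<close>

section \<open>Computable functions\<close>

text \<open>
  Only unary functions are studied in the end, since the pairing function makes other arities
  redundant; binary functions are needed to get the pairing function itself.
\<close>

definition computable :: "(nat \<Rightarrow> nat) \<Rightarrow> bool" where
  "computable f \<longleftrightarrow> (\<exists>r. \<forall>x. computes r [x] (f x))"

definition computable2 :: "(nat \<Rightarrow> nat \<Rightarrow> nat) \<Rightarrow> bool" where
  "computable2 F \<longleftrightarrow> (\<exists>r. \<forall>x y. computes r [x, y] (F x y))"

lemma computable_id: "computable (\<lambda>x. x)"
proof -
  have "computes (Proj 0) [x] x" for x using computes.proj[of 0 "[x]"] by simp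
  then show ?thesis unfolding computable_def by blast
qed

lemma computable_cong:
  assumes "\<And>x. f x = g x" "computable g"
  shows "computable f"
proof -
  have "f = g" using assms(1) by (rule ext)
  then show ?thesis using assms(2) by (simp only:)
qed

lemma computable_comp:
  assumes "computable f" "computable g"
  shows "computable (\<lambda>x. f (g x))"
proof -
  obtain r s where "\<And>x. computes r [x] (f x)" "\<And>x. computes s [x] (g x)"
    using assms unfolding computable_def by blast
  then have "computes (Comp r [s]) [x] (f (g x))" for x
    by (intro computes.comp[where ys = "[g x]"]) auto
  then show ?thesis unfolding computable_def by blast
qed

lemma computable_Suc: "computable f \<Longrightarrow> computable (\<lambda>x. Suc (f x))"
proof (rule computable_comp[where f = Suc])
  show "computable Suc" unfolding computable_def using computes.succ by (intro exI allI)
qed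

lemma computable_const: "computable (\<lambda>x. c)"
proof (induction c)
  case 0
  show ?case unfolding computable_def using computes.zero by (intro exI allI)
qed (rule computable_Suc)

lemma computable_comp2:
  assumes "computable2 F" "computable f" "computable g"
  shows "computable (\<lambda>x. F (f x) (g x))"
proof -
  obtain r s t where "\<And>x y. computes r [x, y] (F x y)" "\<And>x. computes s [x] (f x)"
    "\<And>x. computes t [x] (g x)"
    using assms unfolding computable_def computable2_def by blast
  then have "computes (Comp r [s, t]) [x] (F (f x) (g x))" for x
    by (intro computes.comp[where ys = "[f x, g x]"]) auto
  then show ?thesis unfolding computable_def by blast
qed

lemma computable2_comp:
  assumes "computable2 F" "computable2 G" "computable2 H"
  shows "computable2 (\<lambda>x y. F (G x y) (H x y))"
proof -
  obtain r s t where "\<And>x y. computes r [x, y] (F x y)" "\<And>x y. computes s [x, y] (G x y)"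
    "\<And>x y. computes t [x, y] (H x y)"
    using assms unfolding computable2_def by blast
  then have "computes (Comp r [s, t]) [x, y] (F (G x y) (H x y))" for x y
    by (intro computes.comp[where ys = "[G x y, H x y]"]) auto
  then show ?thesis unfolding computable2_def by blast
qed

lemma computable2_arg1:
  assumes "computable f"
  shows "computable2 (\<lambda>x y. f x)"
proof -
  obtain r where "\<And>x. computes r [x] (f x)" using assms unfolding computable_def by blast
  moreover have "computes (Proj 0) [x, y] x" for x y using computes.proj[of 0 "[x, y]"] by simp
  ultimately have "computes (Comp r [Proj 0]) [x, y] (f x)" for x y
    by (intro computes.comp[where ys = "[x]"]) auto
  then show ?thesis unfolding computable2_def by blast
qed

lemma computable2_arg2:
  assumes "computable f"
  shows "computable2 (\<lambda>x y. f y)"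
proof -
  obtain r where "\<And>x. computes r [x] (f x)" using assms unfolding computable_def by blast
  moreover have "computes (Proj 1) [x, y] y" for x y using computes.proj[of 1 "[x, y]"] by simp
  ultimately have "computes (Comp r [Proj 1]) [x, y] (f y)" for x y
    by (intro computes.comp[where ys = "[y]"]) auto
  then show ?thesis unfolding computable2_def by blast
qed

lemma computable2_funpow:
  assumes "computable f"
  shows "computable2 (\<lambda>m x. (f ^^ m) x)"
proof -
  obtain r where r: "\<And>x. computes r [x] (f x)" using assms unfolding computable_def by blast
  have "computes (Prim (Proj 0) (Comp r [Proj 1])) [m, x] ((f ^^ m) x)" for m x
  proof (induction m)
    case 0
    have "computes (Proj 0) [x] x" using computes.proj[of 0 "[x]"] by simp
    then show ?case using computes.prim_0 by simp
  next
    case (Suc m)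
    have "computes (Proj 1) [m, (f ^^ m) x, x] ((f ^^ m) x)"
      using computes.proj[of 1 "[m, (f ^^ m) x, x]"] by simp
    then have "computes (Comp r [Proj 1]) [m, (f ^^ m) x, x] (f ((f ^^ m) x))"
      using r by (intro computes.comp[where ys = "[(f ^^ m) x]"]) auto
    then show ?case using computes.prim_Suc[OF Suc] by simp
  qed
  then show ?thesis unfolding computable2_def by blast
qed

lemma computable_rec_nat:
  assumes "computable2 G"
  shows "computable (rec_nat 0 G)"
proof -
  obtain r where r: "\<And>x y. computes r [x, y] (G x y)"
    using assms unfolding computable2_def by blast
  have "computes (Prim Zero r) [n] (rec_nat 0 G n)" for n
  proof (induction n)
    case 0
    show ?case using computes.prim_0[OF computes.zero] by simp
  next
    case (Suc n)
    then show ?case using computes.prim_Suc[OF Suc r] by simp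
  qed
  then show ?thesis unfolding computable_def by blast
qed

lemma computable_Least:
  assumes "computable2 F" and zero: "\<And>x. \<exists>c. F c x = 0"
  shows "computable (\<lambda>x. LEAST c. F c x = 0)"
proof -
  obtain r where r: "\<And>c x. computes r [c, x] (F c x)"
    using assms unfolding computable2_def by blast
  have "computes (Mu r) [x] (LEAST c. F c x = 0)" for x
  proof (rule computes.mu)
    show "computes r [LEAST c. F c x = 0, x] 0"
      using r[of "LEAST c. F c x = 0" x] LeastI_ex[OF zero[of x]] by simp
  next
    fix k assume "k < (LEAST c. F c x = 0)"
    then have "F k x \<noteq> 0" by (rule not_less_Least)
    then show "\<exists>y. computes r [k, x] (Suc y)" using r[of k x] by (metis not0_implies_Suc)
  qed
  then show ?thesis unfolding computable_def by blast
qed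

lemma computable2_add: "computable2 (+)"
proof -
  have "(\<lambda>m n. (Suc ^^ m) n) = (+)"
  proof (intro ext)
    show "(Suc ^^ m) n = m + n" for m n by (induction m) auto
  qed
  then show ?thesis using computable2_funpow[OF computable_Suc[OF computable_id]] by (simp only:)
qed

lemma computable2_diff: "computable2 (-)"
proof -
  have "computable (rec_nat 0 (\<lambda>n _. n))"
    by (intro computable_rec_nat computable2_arg1 computable_id)
  moreover have "rec_nat 0 (\<lambda>n _. n) = (\<lambda>n :: nat. n - 1)"
  proof
    show "rec_nat 0 (\<lambda>n _. n) n = n - 1" for n :: nat by (cases n) auto
  qed
  ultimately have pred: "computable (\<lambda>n. n - 1)" by (simp only:)
  have "(\<lambda>m n. ((\<lambda>n. n - 1) ^^ m) n) = (\<lambda>m n. n - m :: nat)"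
  proof (intro ext)
    show "((\<lambda>n. n - 1) ^^ m) n = n - m" for m n :: nat by (induction m) auto
  qed
  then have "computable2 (\<lambda>m n. n - m)" using computable2_funpow[OF pred] by (simp only:)
  then show ?thesis
    using computable2_comp[of "\<lambda>m n. n - m" "\<lambda>x y. y" "\<lambda>x y. x"]
      computable2_arg2[OF computable_id] computable2_arg1[OF computable_id] by blast
qed

lemma computable_triangle: "computable triangle"
proof -
  have "computable2 (\<lambda>n r. r + Suc n)"
    by (intro computable2_comp[OF computable2_add] computable2_arg1 computable2_arg2
        computable_Suc computable_id)
  then have "computable (rec_nat 0 (\<lambda>n r. r + Suc n))" by (rule computable_rec_nat)
  moreover have "rec_nat 0 (\<lambda>n r. r + Suc n) = triangle"
  proof
    show "rec_nat 0 (\<lambda>n r. r + Suc n) n = triangle n" for n by (induction n) auto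
  qed
  ultimately show ?thesis by (simp only:)
qed

lemma computable_add: "computable f \<Longrightarrow> computable g \<Longrightarrow> computable (\<lambda>x. f x + g x)"
  by (rule computable_comp2[OF computable2_add])

lemma computable_diff: "computable f \<Longrightarrow> computable g \<Longrightarrow> computable (\<lambda>x. f x - g x)"
  by (rule computable_comp2[OF computable2_diff])

lemma computable_prod_encode:
  "computable f \<Longrightarrow> computable g \<Longrightarrow> computable (\<lambda>x. prod_encode (f x, g x))"
  unfolding prod_encode_def prod.case
  by (rule computable_add[OF computable_comp[OF computable_triangle computable_add]])

text \<open>
  Diagonal number \<open>k\<close> of the pairing function consists of the codes from
  \<open>triangle k\<close> up to, but excluding, \<open>triangle (Suc k)\<close>, so the sum of the two
  components of a code is found by searching for the first triangular number above it.
\<close>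

lemma sum_prod_decode:
  "fst (prod_decode n) + snd (prod_decode n) = (LEAST k. Suc n - triangle (Suc k) = 0)"
proof -
  obtain a b where ab: "prod_decode n = (a, b)" by (rule prod.exhaust)
  have "prod_encode (a, b) = n" by (metis ab prod_decode_inverse)
  then have n: "n = triangle (a + b) + a" unfolding prod_encode_def prod.case by (rule sym)
  have "(LEAST k. Suc n - triangle (Suc k) = 0) = a + b"
  proof (rule Least_equality)
    show "Suc n - triangle (Suc (a + b)) = 0" unfolding triangle_Suc n by linarith
  next
    fix k assume k: "Suc n - triangle (Suc k) = 0"
    have mono: "triangle i \<le> triangle j" if "i \<le> j" for i j
      using that by (induction rule: dec_induct) auto
    show "a + b \<le> k"
    proof (rule ccontr)
      assume "\<not> a + b \<le> k"
      then have "triangle (Suc k) \<le> triangle (a + b)" by (intro mono) linarith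
      then show False using k n by linarith
    qed
  qed
  then show ?thesis unfolding ab fst_conv snd_conv by (rule sym)
qed

lemma computable_prod_decode:
  assumes "computable f"
  shows "computable (\<lambda>x. fst (prod_decode (f x)))" "computable (\<lambda>x. snd (prod_decode (f x)))"
proof -
  let ?s = "\<lambda>n. LEAST k. Suc n - triangle (Suc k) = 0"
  have "\<exists>k. Suc n - triangle (Suc k) = 0" for n
  proof
    show "Suc n - triangle (Suc n) = 0" by (induction n) auto
  qed
  moreover have "computable2 (\<lambda>k n. Suc n - triangle (Suc k))"
    by (intro computable2_comp[OF computable2_diff] computable2_arg1 computable2_arg2
        computable_Suc computable_id computable_comp[OF computable_triangle])
  ultimately have s: "computable ?s"
    by (intro computable_Least[where F = "\<lambda>k n. Suc n - triangle (Suc k)"])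
  have 1: "fst (prod_decode n) = n - triangle (?s n)" for n
  proof -
    have "prod_encode (fst (prod_decode n), snd (prod_decode n)) = n" by simp
    then show ?thesis unfolding prod_encode_def prod.case sum_prod_decode by linarith
  qed
  have fst: "computable (\<lambda>n. fst (prod_decode n))"
    using 1 by (rule computable_cong)
      (intro computable_diff computable_id computable_comp[OF computable_triangle] s)
  have "snd (prod_decode n) = ?s n - fst (prod_decode n)" for n
    using sum_prod_decode[of n] by linarith
  then have snd: "computable (\<lambda>n. snd (prod_decode n))"
    using computable_diff[OF s fst] by (rule computable_cong)
  show "computable (\<lambda>x. fst (prod_decode (f x)))" "computable (\<lambda>x. snd (prod_decode (f x)))"
    by (rule computable_comp[OF fst assms], rule computable_comp[OF snd assms])
qed

lemma computable_funpow:
  "computable h \<Longrightarrow> computable f \<Longrightarrow> computable g \<Longrightarrow> computable (\<lambda>x. (h ^^ f x) (g x))"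
  by (rule computable_comp2[OF computable2_funpow])

lemma computable_if:
  assumes "computable f" "computable g" "computable h"
  shows "computable (\<lambda>x. if f x = 0 then g x else h x)"
proof -
  \<comment> \<open>Overwriting the first component by the second does nothing only when it is done zero times.\<close>
  let ?o = "\<lambda>p. prod_encode (snd (prod_decode p), snd (prod_decode p))"
  have "fst (prod_decode ((?o ^^ m) (prod_encode (a, b)))) = (if m = 0 then a else b)
    \<and> snd (prod_decode ((?o ^^ m) (prod_encode (a, b)))) = b" for m a b
    by (induction m) auto
  then have "(if f x = 0 then g x else h x) =
      fst (prod_decode ((?o ^^ f x) (prod_encode (g x, h x))))" for x
    by simp
  moreover have "computable (\<lambda>x. fst (prod_decode ((?o ^^ f x) (prod_encode (g x, h x)))))"
    by (intro computable_funpow computable_prod_decode computable_prod_encode computable_id assms)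
  ultimately show ?thesis by (rule computable_cong)
qed

lemmas computable_intros = computable_id computable_const computable_Suc computable_add
  computable_diff computable_prod_encode computable_prod_decode computable_funpow computable_if

section \<open>Semidecidable predicates\<close>

definition semidec :: "(nat \<Rightarrow> bool) \<Rightarrow> bool" where
  "semidec P \<longleftrightarrow> (\<exists>f. computable f \<and> (\<forall>x. P x \<longleftrightarrow> (\<exists>c. f (prod_encode (x, c)) = 0)))"

definition semidec2 :: "(nat \<Rightarrow> nat \<Rightarrow> bool) \<Rightarrow> bool" where
  "semidec2 R \<longleftrightarrow> semidec (\<lambda>n. R (fst (prod_decode n)) (snd (prod_decode n)))"

lemma semidecI:
  assumes "computable h" "\<And>x. P x \<longleftrightarrow> (\<exists>c. h (prod_encode (x, c)) = 0)"
  shows "semidec P"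
  unfolding semidec_def using assms by (intro exI[of _ h] conjI allI)

lemma semidec_cong:
  assumes "\<And>x. P x \<longleftrightarrow> Q x" "semidec Q"
  shows "semidec P"
proof -
  have "P = Q" using assms(1) by (rule ext)
  then show ?thesis using assms(2) by (simp only:)
qed

lemma semidec_comp:
  assumes "semidec P" "computable g"
  shows "semidec (\<lambda>x. P (g x))"
proof -
  obtain f where f: "computable f" "\<And>x. P x \<longleftrightarrow> (\<exists>c. f (prod_encode (x, c)) = 0)"
    using assms unfolding semidec_def by blast
  let ?h = "\<lambda>n. f (prod_encode (g (fst (prod_decode n)), snd (prod_decode n)))"
  have "computable ?h"
    by (intro computable_comp[OF f(1)] computable_comp[OF assms(2)] computable_intros)
  moreover have "P (g x) \<longleftrightarrow> (\<exists>c. ?h (prod_encode (x, c)) = 0)" for x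
    by (simp add: f(2))
  ultimately show ?thesis by (rule semidecI)
qed

lemma semidec2_comp:
  assumes "semidec2 R" "computable f" "computable g"
  shows "semidec (\<lambda>x. R (f x) (g x))"
  using semidec_comp[OF assms(1)[unfolded semidec2_def] computable_prod_encode[OF assms(2,3)]]
  by simp

lemma semidec_eq:
  assumes "computable f" "computable g"
  shows "semidec (\<lambda>x. f x = g x)"
proof -
  let ?h = "\<lambda>n. (f (fst (prod_decode n)) - g (fst (prod_decode n)))
    + (g (fst (prod_decode n)) - f (fst (prod_decode n)))"
  have "computable ?h"
    by (intro computable_intros computable_comp[OF assms(1)] computable_comp[OF assms(2)])
  moreover have "f x = g x \<longleftrightarrow> (\<exists>c. ?h (prod_encode (x, c)) = 0)" for x by auto
  ultimately show ?thesis by (rule semidecI)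
qed

lemma semidec_neq:
  assumes "computable f" "computable g"
  shows "semidec (\<lambda>x. f x \<noteq> g x)"
proof -
  have "semidec (\<lambda>x. 1 - ((f x - g x) + (g x - f x)) = 0)"
    by (intro semidec_eq computable_intros assms)
  moreover have "1 - ((f x - g x) + (g x - f x)) = 0 \<longleftrightarrow> f x \<noteq> g x" for x by auto
  ultimately show ?thesis by (simp only:)
qed

lemma semidec_const: "semidec (\<lambda>x. b)"
  using semidec_eq[of "\<lambda>x. 0" "\<lambda>x. 0"] semidec_eq[of "\<lambda>x. 0" "\<lambda>x. 1"]
  by (cases b) (simp_all add: computable_intros)

lemma semidec_disj:
  assumes "semidec P" "semidec Q"
  shows "semidec (\<lambda>x. P x \<or> Q x)"
proof -
  obtain f g where f: "computable f" "\<And>x. P x \<longleftrightarrow> (\<exists>c. f (prod_encode (x, c)) = 0)"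
    and g: "computable g" "\<And>x. Q x \<longleftrightarrow> (\<exists>c. g (prod_encode (x, c)) = 0)"
    using assms unfolding semidec_def by metis
  let ?h = "\<lambda>n. if f n = 0 then 0 else g n"
  have "computable ?h" by (intro computable_intros f g)
  moreover have "P x \<or> Q x \<longleftrightarrow> (\<exists>c. ?h (prod_encode (x, c)) = 0)" for x
    unfolding f(2) g(2) by metis
  ultimately show ?thesis by (rule semidecI)
qed

lemma semidec_ex:
  assumes "semidec2 R"
  shows "semidec (\<lambda>x. \<exists>y. R x y)"
proof -
  obtain f where f: "computable f"
    "\<And>x y. R x y \<longleftrightarrow> (\<exists>c. f (prod_encode (prod_encode (x, y), c)) = 0)"
    using assms unfolding semidec_def semidec2_def
    by (metis fst_conv prod_encode_inverse snd_conv)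
  let ?h = "\<lambda>n. f (prod_encode (prod_encode (fst (prod_decode n), fst (prod_decode (snd (prod_decode n)))),
    snd (prod_decode (snd (prod_decode n)))))"
  have "computable ?h" by (intro computable_comp[OF f(1)] computable_intros)
  moreover have "(\<exists>y. R x y) \<longleftrightarrow> (\<exists>c. ?h (prod_encode (x, c)) = 0)" for x
    unfolding f(2) prod_encode_inverse fst_conv snd_conv
    by (metis fst_conv prod_encode_inverse snd_conv)
  ultimately show ?thesis by (rule semidecI)
qed

lemma semidec_conj:
  assumes "semidec P" "semidec Q"
  shows "semidec (\<lambda>x. P x \<and> Q x)"
proof -
  obtain f g where f: "computable f" "\<And>x. P x \<longleftrightarrow> (\<exists>c. f (prod_encode (x, c)) = 0)"
    and g: "computable g" "\<And>x. Q x \<longleftrightarrow> (\<exists>c. g (prod_encode (x, c)) = 0)"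
    using assms unfolding semidec_def by metis
  let ?h = "\<lambda>n. f (prod_encode (fst (prod_decode n), fst (prod_decode (snd (prod_decode n)))))
    + g (prod_encode (fst (prod_decode n), snd (prod_decode (snd (prod_decode n)))))"
  have "computable ?h" by (intro computable_intros computable_comp[OF f(1)] computable_comp[OF g(1)])
  moreover have "P x \<and> Q x \<longleftrightarrow> (\<exists>c. ?h (prod_encode (x, c)) = 0)" for x
    unfolding f(2) g(2) prod_encode_inverse fst_conv snd_conv add_eq_0_iff_both_eq_0
    by (metis fst_conv prod_encode_inverse snd_conv)
  ultimately show ?thesis by (rule semidecI)
qed

lemma semidec_bex:
  assumes "finite I" "\<And>i. i \<in> I \<Longrightarrow> semidec (P i)"
  shows "semidec (\<lambda>x. \<exists>i\<in>I. P i x)"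
  using assms by (induction I) (auto intro: semidec_const semidec_disj)

lemma semidec_ball:
  assumes "finite I" "\<And>i. i \<in> I \<Longrightarrow> semidec (P i)"
  shows "semidec (\<lambda>x. \<forall>i\<in>I. P i x)"
  using assms by (induction I) (auto intro: semidec_const semidec_conj)

text \<open>
  A certificate for \<open>R\<^sup>*\<^sup>* x y\<close> is a list of intermediate points, each with a certificate
  for the step into it. The function \<open>h\<close> below consumes one entry of the list and moves to the
  point given there if the certificate is correct; otherwise it stays. Thus every number, read as a
  list, leads to a point reachable from \<open>x\<close>, and no well-formedness has to be tested.
\<close>

lemma semidec2_rtranclp:
  assumes "semidec2 R"
  shows "semidec2 R\<^sup>*\<^sup>*"
proof -
  obtain f where f: "computable f"
    "\<And>x y. R x y \<longleftrightarrow> (\<exists>c. f (prod_encode (prod_encode (x, y), c)) = 0)"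
    using assms unfolding semidec_def semidec2_def
    by (metis fst_conv prod_encode_inverse snd_conv)
  define h where "h p =
    (let x = fst (prod_decode p); e = fst (prod_decode (snd (prod_decode p)));
         l = snd (prod_decode (snd (prod_decode p))); y = fst (prod_decode e)
     in prod_encode (if f (prod_encode (prod_encode (x, y), snd (prod_decode e))) = 0 then y else x, l))"
    for p
  have h: "computable h"
    unfolding h_def Let_def by (intro computable_intros computable_comp[OF f(1)])
  have step: "R\<^sup>*\<^sup>* (fst (prod_decode p)) (fst (prod_decode (h p)))" for p
    using f(2) by (auto simp: h_def Let_def)
  have sound: "R\<^sup>*\<^sup>* x (fst (prod_decode ((h ^^ k) (prod_encode (x, l)))))" for k x l
  proof (induction k)
    case (Suc k)
    then show ?case using step[of "(h ^^ k) (prod_encode (x, l))"] by simp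
  qed simp
  have complete: "\<exists>k l. fst (prod_decode ((h ^^ k) (prod_encode (x, l)))) = y" if "R\<^sup>*\<^sup>* x y" for x y
    using that
  proof (induction rule: converse_rtranclp_induct)
    case base
    show ?case by (rule exI[of _ 0]) simp
  next
    case (step x z)
    then obtain k l c where kl: "fst (prod_decode ((h ^^ k) (prod_encode (z, l)))) = y"
      and c: "f (prod_encode (prod_encode (x, z), c)) = 0" using f(2) by blast
    have "h (prod_encode (x, prod_encode (prod_encode (z, c), l))) = prod_encode (z, l)"
      using c by (simp add: h_def)
    then have "fst (prod_decode ((h ^^ Suc k)
        (prod_encode (x, prod_encode (prod_encode (z, c), l))))) = y"
      using kl by (simp add: funpow_Suc_right del: funpow.simps)
    then show ?case by blast
  qed
  have "R\<^sup>*\<^sup>* = (\<lambda>x y.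
      \<exists>c. fst (prod_decode ((h ^^ fst (prod_decode c)) (prod_encode (x, snd (prod_decode c))))) = y)"
  proof (intro ext iffI)
    fix x y assume "R\<^sup>*\<^sup>* x y"
    then obtain k l where "fst (prod_decode ((h ^^ k) (prod_encode (x, l)))) = y"
      using complete by blast
    then show "\<exists>c. fst (prod_decode ((h ^^ fst (prod_decode c)) (prod_encode (x, snd (prod_decode c))))) = y"
      by (intro exI[of _ "prod_encode (k, l)"]) simp
  next
    fix x y assume
      "\<exists>c. fst (prod_decode ((h ^^ fst (prod_decode c)) (prod_encode (x, snd (prod_decode c))))) = y"
    then show "R\<^sup>*\<^sup>* x y" using sound by blast
  qed
  moreover have "semidec2 \<dots>"
    unfolding semidec2_def
    by (rule semidec_ex, unfold semidec2_def) (intro semidec_eq computable_intros h)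
  ultimately show ?thesis by simp
qed

text \<open>
  Half of Post's theorem: a search for a certificate of membership or of non-membership always ends,
  and the least number found is a certificate for exactly one of the two.
\<close>

lemma decidable_set_if_semidec:
  assumes "semidec (\<lambda>n. n \<in> D)" "semidec (\<lambda>n. n \<notin> D)"
  shows "decidable_set D"
proof -
  obtain f g where f: "computable f" "\<And>x. x \<in> D \<longleftrightarrow> (\<exists>c. f (prod_encode (x, c)) = 0)"
    and g: "computable g" "\<And>x. x \<notin> D \<longleftrightarrow> (\<exists>c. g (prod_encode (x, c)) = 0)"
    using assms unfolding semidec_def by metis
  let ?h = "\<lambda>n. if f n = 0 then 0 else g n"
  let ?s = "\<lambda>x. LEAST c. ?h (prod_encode (x, c)) = 0"
  have total: "\<exists>c. ?h (prod_encode (x, c)) = 0" for x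
    by (metis f(2) g(2))
  have pair: "computable2 (\<lambda>c x. prod_encode (x, c))"
    unfolding prod_encode_def prod.case
    by (intro computable2_comp[OF computable2_add] computable2_arg1 computable2_arg2 computable_id
        computable2_comp[OF computable2_arg1[OF computable_triangle] _ computable2_arg1[OF computable_id]])
  have "computable2 (\<lambda>c x. ?h (prod_encode (x, c)))"
    using computable2_comp[OF computable2_arg1[where f = ?h] pair pair]
    by (simp add: computable_if computable_const f(1) g(1))
  then have s: "computable ?s" by (rule computable_Least) (rule total)
  have "computable (\<lambda>x. if f (prod_encode (x, ?s x)) = 0 then 1 else 0)"
    by (intro computable_intros s computable_comp[OF f(1)])
  moreover have "f (prod_encode (x, ?s x)) = 0 \<longleftrightarrow> x \<in> D" for x
  proof
    assume "x \<in> D"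
    then have "g (prod_encode (x, c)) \<noteq> 0" for c using g(2)[of x] by simp
    then show "f (prod_encode (x, ?s x)) = 0" using LeastI_ex[OF total[of x]] by presburger
  qed (use f(2) in blast)
  ultimately show ?thesis unfolding decidable_set_def computable_def by simp
qed


lemmas semidec_intros = semidec_eq semidec_neq semidec_conj semidec_disj semidec_const
  semidec_ex[unfolded semidec2_def] computable_intros

section \<open>Semidecidable relations between words\<close>

definition semidec_rel :: "(nat list \<times> nat list) set \<Rightarrow> bool" where
  "semidec_rel R \<longleftrightarrow> semidec2 (\<lambda>x y. (list_decode x, list_decode y) \<in> R)"

lemma semidec_relI:
  assumes "\<And>x y. (list_decode x, list_decode y) \<in> R \<longleftrightarrow> Q x y" "semidec2 Q"
  shows "semidec_rel R"
  unfolding semidec_rel_def semidec2_def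
  using assms(1) assms(2)[unfolded semidec2_def] by (rule semidec_cong)

lemma list_decode_eq_iff: "list_decode x = list_decode y \<longleftrightarrow> x = y"
  by (metis list_decode_inverse)

lemma semidec_rel_Id: "semidec_rel Id"
  unfolding semidec_rel_def semidec2_def pair_in_Id_conv list_decode_eq_iff
  by (intro semidec_intros)

lemma semidec_rel_relcomp:
  assumes "semidec_rel R" "semidec_rel S"
  shows "semidec_rel (R O S)"
proof -
  have "(list_decode x, list_decode y) \<in> R O S \<longleftrightarrow>
      (\<exists>z. (list_decode x, list_decode z) \<in> R \<and> (list_decode z, list_decode y) \<in> S)" for x y
    unfolding relcomp_unfold mem_Collect_eq prod.case by (metis list_encode_inverse)
  moreover have "semidec2 (\<lambda>x y. \<exists>z. (list_decode x, list_decode z) \<in> R \<and> (list_decode z, list_decode y) \<in> S)"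
    unfolding semidec2_def
    by (intro semidec_ex[unfolded semidec2_def] semidec_conj
        semidec2_comp[OF assms(1)[unfolded semidec_rel_def]]
        semidec2_comp[OF assms(2)[unfolded semidec_rel_def]] computable_intros)
  ultimately show ?thesis by (rule semidec_relI)
qed

lemma semidec_lists:
  assumes "finite A"
  shows "semidec (\<lambda>n. list_decode n \<in> lists A)"
proof -
  \<comment> \<open>Removing the first letter of a coded word, provided that it belongs to \<open>A\<close>.\<close>
  let ?R = "\<lambda>x y. \<exists>a\<in>A. x = Suc (prod_encode (a, y))"
  have iff: "?R\<^sup>*\<^sup>* (list_encode w) 0 \<longleftrightarrow> w \<in> lists A" for w
  proof
    assume "w \<in> lists A"
    then show "?R\<^sup>*\<^sup>* (list_encode w) 0"
    proof (induction w)
      case (Cons a w)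
      then have "?R (list_encode (a # w)) (list_encode w)" by auto
      then show ?case using Cons.IH by (rule converse_rtranclp_into_rtranclp)
    qed simp
  next
    assume "?R\<^sup>*\<^sup>* (list_encode w) 0"
    then show "w \<in> lists A"
    proof (induction w)
      case (Cons a w)
      from Cons.prems obtain y where y: "?R (list_encode (a # w)) y" "?R\<^sup>*\<^sup>* y 0"
        by (cases rule: converse_rtranclpE) auto
      from y(1) have "a \<in> A" "y = list_encode w" by auto
      then show ?case using Cons.IH y(2) by simp
    qed simp
  qed
  have "list_decode n \<in> lists A \<longleftrightarrow> ?R\<^sup>*\<^sup>* n 0" for n
    using iff[of "list_decode n"] unfolding list_decode_inverse by (rule sym)
  moreover have "semidec2 ?R"
    unfolding semidec2_def by (intro semidec_bex assms semidec_intros)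
  then have "semidec (\<lambda>n. ?R\<^sup>*\<^sup>* n 0)"
    by (rule semidec2_comp[OF semidec2_rtranclp computable_id computable_const])
  ultimately show ?thesis by (rule semidec_cong)
qed

section \<open>Asynchronous two-tape pushdown automata\<close>

definition sharp :: "('c + 'd) list \<Rightarrow> 'c list" where
  "sharp w = map projl (filter isl w)"

definition flat :: "('c + 'd) list \<Rightarrow> 'd list" where
  "flat w = map projr (filter (\<lambda>x. \<not> isl x) w)"

lemma sharp_simps [simp]:
  "sharp [] = []" "sharp (Inl x # w) = x # sharp w" "sharp (Inr y # w) = sharp w"
  "sharp (v @ w) = sharp v @ sharp w" "sharp (map Inl us) = us" "sharp (map Inr vs) = []"
  by (simp_all add: sharp_def comp_def)

lemma flat_simps [simp]:
  "flat [] = []" "flat (Inl x # w) = flat w" "flat (Inr y # w) = y # flat w"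
  "flat (v @ w) = flat v @ flat w" "flat (map Inl us) = []" "flat (map Inr vs) = vs"
  by (simp_all add: flat_def comp_def)

text \<open>
  Cutting a word over the two copies of the alphabet into maximal blocks is always possible and
  meets the nonemptiness conditions, so shuffling is inverse to projecting to the two tapes.
\<close>

lemma is_shuffle_iff: "is_shuffle u v w \<longleftrightarrow> u = sharp w \<and> v = flat w"
proof
  assume "is_shuffle u v w"
  then obtain us vs where "length us = length vs" and uv: "u = concat us" "v = concat vs"
    and w: "w = concat (map2 (\<lambda>x y. map Inl x @ map Inr y) us vs)"
    unfolding is_shuffle_def by blast
  from this(1) show "u = sharp w \<and> v = flat w"
    unfolding uv w by (induction us vs rule: list_induct2) auto
next
  have tl: "(\<forall>i. 0 < i \<and> i < length xs \<longrightarrow> xs ! i \<noteq> []) \<longleftrightarrow> [] \<notin> set (tl xs)" for xs :: "'a list list"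
    by (cases xs) (auto simp: in_set_conv_nth gr0_conv_Suc)
  have butlast: "(\<forall>j. Suc j < length xs \<longrightarrow> xs ! j \<noteq> []) \<longleftrightarrow> [] \<notin> set (butlast xs)"
    for xs :: "'a list list"
    by (auto simp: in_set_conv_nth nth_butlast)
  have "\<exists>us vs. length us = length vs \<and> concat us = sharp w \<and> concat vs = flat w \<and>
      [] \<notin> set (tl us) \<and> [] \<notin> set (butlast vs) \<and>
      w = concat (map2 (\<lambda>x y. map Inl x @ map Inr y) us vs)"
  proof (induction w)
    case Nil
    show ?case by (intro exI[of _ "[]"]) simp
  next
    case (Cons c w)
    then obtain us vs where IH: "length us = length vs" "concat us = sharp w" "concat vs = flat w"
      "[] \<notin> set (tl us)" "[] \<notin> set (butlast vs)"
      "w = concat (map2 (\<lambda>x y. map Inl x @ map Inr y) us vs)" by blast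
    show ?case
    proof (cases us)
      case Nil
      then have "w = []" using IH(6) by simp
      then show ?thesis
        by (cases c) (rule exI[of _ "[[projl c]]"], rule exI[of _ "[[]]"], simp,
            rule exI[of _ "[[]]"], rule exI[of _ "[[projr c]]"], simp)
    next
      case us: (Cons x us')
      then obtain y vs' where vs: "vs = y # vs'" using IH(1) by (cases vs) auto
      show ?thesis
      proof (cases c)
        case (Inl a)
        show ?thesis using IH us vs Inl
          by (intro exI[of _ "(a # x) # us'"] exI[of _ vs]) auto
      next
        case (Inr b)
        \<comment> \<open>A flat letter joins the first flat block unless a sharp letter comes in between.\<close>
        show ?thesis
        proof (cases x)
          case Nil
          then show ?thesis using IH us vs Inr
            by (intro exI[of _ us] exI[of _ "(b # y) # vs'"]) (auto split: if_splits)
        next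
          case (Cons a x')
          then show ?thesis using IH us vs Inr
            by (intro exI[of _ "[] # us"] exI[of _ "[b] # vs"]) auto
        qed
      qed
    qed
  qed
  then have "is_shuffle (sharp w) (flat w) w" unfolding is_shuffle_def tl butlast by blast
  then show "u = sharp w \<and> v = flat w \<Longrightarrow> is_shuffle u v w" by simp
qed

fun letter_code :: "nat option \<Rightarrow> nat" where
  "letter_code None = 0"
| "letter_code (Some a) = Suc a"

definition tape_code :: "nat option list \<Rightarrow> nat" where
  "tape_code u = list_encode (map letter_code u)"

definition quadruple :: "nat \<Rightarrow> nat \<Rightarrow> nat \<Rightarrow> nat \<Rightarrow> nat" where
  "quadruple a b c d = prod_encode (a, prod_encode (b, prod_encode (c, d)))"

text \<open>
  The code forgets how the two tapes are interleaved. A run on codes therefore guesses the shuffle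
  while it proceeds, and the shuffle can be read off from the run afterwards. The stack is reversed so
  that its top is the head of the coded list.
\<close>

fun config_code :: "(nat tape_letter, nat, nat) config \<Rightarrow> nat" where
  "config_code (w, z, s) =
     quadruple (tape_code (sharp w)) (tape_code (flat w)) (list_encode (rev z)) s"

definition prepend :: "nat list \<Rightarrow> nat \<Rightarrow> nat" where
  "prepend xs n = list_encode (xs @ list_decode n)"

lemma quadruple_eq_iff [simp]:
  "quadruple a b c d = quadruple a' b' c' d' \<longleftrightarrow> a = a' \<and> b = b' \<and> c = c' \<and> d = d'"
  by (simp add: quadruple_def)

lemma tape_code_eq_iff [simp]: "tape_code u = tape_code v \<longleftrightarrow> u = v"
proof -
  have "inj letter_code"
  proof (rule injI)
    fix x y assume "letter_code x = letter_code y"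
    then show "x = y" by (cases x; cases y) auto
  qed
  then show ?thesis by (simp add: tape_code_def list_encode_eq)
qed

lemma computable_quadruple:
  "computable f \<Longrightarrow> computable g \<Longrightarrow> computable h \<Longrightarrow> computable k \<Longrightarrow>
    computable (\<lambda>x. quadruple (f x) (g x) (h x) (k x))"
  unfolding quadruple_def by (intro computable_prod_encode)

lemma computable_prepend:
  assumes "computable f"
  shows "computable (\<lambda>x. prepend xs (f x))"
proof (induction xs)
  case Nil
  show ?case using assms by (simp add: prepend_def)
next
  case (Cons a xs)
  have "prepend (a # xs) n = Suc (prod_encode (a, prepend xs n))" for n by (simp add: prepend_def)
  then show ?case by (rule computable_cong) (intro computable_intros Cons)
qed

abbreviation option_list :: "'a option \<Rightarrow> 'a list" where
  "option_list x \<equiv> (case x of None \<Rightarrow> [] | Some a \<Rightarrow> [a])"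

lemma dpda_move_iff:
  "dpda_move M x c c' \<longleftrightarrow>
    (\<exists>b s t \<alpha> v y. dpda_trans M (x, b, s) = Some (t, \<alpha>) \<and>
       c = (option_list x @ v, y @ [b], s) \<and> c' = (v, y @ \<alpha>, t))"
proof
  show "dpda_move M x c c' \<Longrightarrow> \<exists>b s t \<alpha> v y. dpda_trans M (x, b, s) = Some (t, \<alpha>) \<and>
       c = (option_list x @ v, y @ [b], s) \<and> c' = (v, y @ \<alpha>, t)"
    by (cases rule: dpda_move.cases) fastforce+
qed (cases x, auto intro: dpda_move.intros)

definition tape_rules ::
  "(nat tape_letter, nat, nat) dpda \<Rightarrow> nat set \<Rightarrow> nat set \<Rightarrow>
     (nat tape_letter option \<times> nat \<times> nat \<times> nat \<times> nat list) set" where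
  "tape_rules T Sh Fl =
     {(x, b, s, t, \<alpha>). dpda_trans T (x, b, s) = Some (t, \<alpha>) \<and> may_read Sh Fl x s}"

text \<open>
  Here \<open>m\<close> and \<open>n\<close> code what remains on the tapes, and \<open>k\<close> the stack below
  its top symbol \<open>b\<close>.
\<close>

fun coded_rule ::
  "nat tape_letter option \<times> nat \<times> nat \<times> nat \<times> nat list \<Rightarrow> nat \<Rightarrow> nat \<Rightarrow> bool" where
  "coded_rule (x, b, s, t, \<alpha>) c c' \<longleftrightarrow>
     (\<exists>m n k.
        c = quadruple (prepend (map letter_code (sharp (option_list x))) m)
              (prepend (map letter_code (flat (option_list x))) n) (prepend [b] k) s \<and>
        c' = quadruple m n (prepend (rev \<alpha>) k) t)"

definition coded_step ::
  "(nat tape_letter, nat, nat) dpda \<Rightarrow> nat set \<Rightarrow> nat set \<Rightarrow> nat \<Rightarrow> nat \<Rightarrow> bool" where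
  "coded_step T Sh Fl c c' \<longleftrightarrow> (\<exists>r \<in> tape_rules T Sh Fl. coded_rule r c c')"

lemma finite_tape_rules:
  assumes "dpda T"
  shows "finite (tape_rules T Sh Fl)"
proof -
  have "finite (insert None (Some ` dpda_inputs T) \<times> dpda_stack T \<times> dpda_states T)"
    using assms unfolding dpda_def by simp
  then have "finite (dom (dpda_trans T))"
    using assms unfolding dpda_def by (meson finite_subset)
  moreover have "tape_rules T Sh Fl \<subseteq>
      (\<lambda>(x, b, s). (x, b, s, the (dpda_trans T (x, b, s)))) ` dom (dpda_trans T)"
    unfolding tape_rules_def by force
  ultimately show ?thesis by (meson finite_surj)
qed

lemma semidec2_coded_step:
  assumes "dpda T"
  shows "semidec2 (coded_step T Sh Fl)"
proof -
  have "semidec2 (coded_rule r)" for r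
  proof (cases r)
    case (fields x b s t \<alpha>)
    show ?thesis
      unfolding fields semidec2_def coded_rule.simps
      by (intro semidec_intros computable_quadruple computable_prepend)
  qed
  then show ?thesis
    unfolding coded_step_def semidec2_def by (intro semidec_bex finite_tape_rules assms)
qed

lemma coded_step_config_code:
  assumes "tape_step T Sh Fl c c'"
  shows "coded_step T Sh Fl (config_code c) (config_code c')"
proof -
  obtain x b s t \<alpha> v y where "dpda_trans T (x, b, s) = Some (t, \<alpha>)" "may_read Sh Fl x s"
    and c: "c = (option_list x @ v, y @ [b], s)" "c' = (v, y @ \<alpha>, t)"
    using assms unfolding tape_step_def dpda_move_iff by auto
  then have "(x, b, s, t, \<alpha>) \<in> tape_rules T Sh Fl" by (simp add: tape_rules_def)
  moreover have "coded_rule (x, b, s, t, \<alpha>) (config_code c) (config_code c')"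
    unfolding c coded_rule.simps config_code.simps
    by (rule exI[of _ "tape_code (sharp v)"], rule exI[of _ "tape_code (flat v)"],
        rule exI[of _ "list_encode (rev y)"])
      (simp add: tape_code_def prepend_def)
  ultimately show ?thesis unfolding coded_step_def by blast
qed

text \<open>
  The code of a configuration does not determine the configuration, but a step can be lifted
  backwards: the letter that it reads is put in front of the given shuffle of the remaining tapes.
\<close>

lemma coded_step_into_config_code:
  assumes "coded_step T Sh Fl n (config_code c')"
  obtains c where "n = config_code c" "tape_step T Sh Fl c c'"
proof -
  obtain w z t' where c': "c' = (w, z, t')" by (rule prod_cases3)
  obtain x b s t \<alpha> where r: "(x, b, s, t, \<alpha>) \<in> tape_rules T Sh Fl"
    and step: "coded_rule (x, b, s, t, \<alpha>) n (config_code c')"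
    using assms unfolding coded_step_def by (metis prod_cases5)
  then obtain k where
    n: "n = quadruple (prepend (map letter_code (sharp (option_list x))) (tape_code (sharp w)))
          (prepend (map letter_code (flat (option_list x))) (tape_code (flat w))) (prepend [b] k) s"
    and k: "prepend (rev \<alpha>) k = list_encode (rev z)" and t: "t' = t"
    unfolding c' by auto
  define y where "y = rev (list_decode k)"
  from k have "rev \<alpha> @ list_decode k = rev z" unfolding prepend_def list_encode_eq .
  then have "rev (rev \<alpha> @ list_decode k) = rev (rev z)" by (simp only:)
  then have z: "z = y @ \<alpha>" unfolding y_def by simp
  show thesis
  proof
    show "n = config_code (option_list x @ w, y @ [b], s)"
      unfolding n config_code.simps by (simp add: tape_code_def prepend_def y_def)
    show "tape_step T Sh Fl (option_list x @ w, y @ [b], s) c'"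
      using r unfolding tape_step_def dpda_move_iff c' z t tape_rules_def by auto
  qed
qed

lemma coded_steps_iff:
  "(coded_step T Sh Fl)\<^sup>*\<^sup>* n (config_code c') \<longleftrightarrow>
    (\<exists>c. n = config_code c \<and> (tape_step T Sh Fl)\<^sup>*\<^sup>* c c')"
proof
  assume "(coded_step T Sh Fl)\<^sup>*\<^sup>* n (config_code c')"
  then show "\<exists>c. n = config_code c \<and> (tape_step T Sh Fl)\<^sup>*\<^sup>* c c'"
  proof (induction rule: converse_rtranclp_induct)
    case (step n n')
    then show ?case by (metis coded_step_into_config_code converse_rtranclp_into_rtranclp)
  qed blast
next
  have "(coded_step T Sh Fl)\<^sup>*\<^sup>* (config_code c) (config_code c')"
    if "(tape_step T Sh Fl)\<^sup>*\<^sup>* c c'" for c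
    using that
  proof (induction rule: rtranclp_induct)
    case (step d e)
    then show ?case by (metis coded_step_config_code rtranclp.rtrancl_into_rtrancl)
  qed simp
  then show "\<exists>c. n = config_code c \<and> (tape_step T Sh Fl)\<^sup>*\<^sup>* c c' \<Longrightarrow>
      (coded_step T Sh Fl)\<^sup>*\<^sup>* n (config_code c')" by blast
qed

lemma two_tape_accepts_iff:
  "(\<exists>w c. is_shuffle u v w \<and> (tape_step T Sh Fl)\<^sup>*\<^sup>* (dpda_init T w) c \<and> dpda_accepting T m c) \<longleftrightarrow>
   (\<exists>z s. dpda_accepting T m ([], z, s) \<and>
     (coded_step T Sh Fl)\<^sup>*\<^sup>*
       (quadruple (tape_code u) (tape_code v) (list_encode [dpda_bottom T]) (dpda_start T))
       (quadruple 0 0 (list_encode (rev z)) s))"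
  (is "?L \<longleftrightarrow> ?R")
proof -
  let ?n = "quadruple (tape_code u) (tape_code v) (list_encode [dpda_bottom T]) (dpda_start T)"
  have init: "?n = config_code c \<longleftrightarrow> (\<exists>w. c = dpda_init T w \<and> is_shuffle u v w)" for c
  proof (cases c)
    case (fields w z s)
    have "[dpda_bottom T] = rev z \<longleftrightarrow> z = [dpda_bottom T]" by (metis rev_singleton_conv)
    then show ?thesis
      unfolding fields dpda_init_def is_shuffle_iff config_code.simps quadruple_eq_iff
        tape_code_eq_iff list_encode_eq by auto
  qed
  have reach: "(coded_step T Sh Fl)\<^sup>*\<^sup>* ?n (quadruple 0 0 (list_encode (rev z)) s) \<longleftrightarrow>
      (\<exists>w. is_shuffle u v w \<and> (tape_step T Sh Fl)\<^sup>*\<^sup>* (dpda_init T w) ([], z, s))" for z s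
  proof -
    have "quadruple 0 0 (list_encode (rev z)) s = config_code ([], z, s)"
      by (simp add: tape_code_def)
    then show ?thesis by (simp only: coded_steps_iff init) blast
  qed
  have accepting: "\<exists>z s. c = ([], z, s)" if "dpda_accepting T m c" for c
    using that by (cases c; cases m) auto
  show ?thesis
    unfolding reach
  proof
    assume ?L
    then obtain w c where "is_shuffle u v w" "(tape_step T Sh Fl)\<^sup>*\<^sup>* (dpda_init T w) c"
      "dpda_accepting T m c" by (elim exE conjE)
    moreover from this(3) obtain z s where "c = ([], z, s)" by (elim accepting[THEN exE] exE)
    ultimately show "\<exists>z s. dpda_accepting T m ([], z, s) \<and>
        (\<exists>w. is_shuffle u v w \<and> (tape_step T Sh Fl)\<^sup>*\<^sup>* (dpda_init T w) ([], z, s))"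
      by (intro exI conjI) (simp_all only:)
  qed (elim exE conjE, intro exI conjI)
qed

text \<open>
  Marking the end of a word recodes all its letters. Instead of computing this recoding, the proof
  verifies it by stripping the first letters of the plain and of the marked word in parallel until
  only the end marker is left.
\<close>

lemma semidec2_end_marked: "semidec2 (\<lambda>x t. t = tape_code (end_marked (list_decode x)))"
proof -
  let ?R = "\<lambda>x y. \<exists>a. x = prod_encode (Suc (prod_encode (a, fst (prod_decode y))),
    Suc (prod_encode (Suc a, snd (prod_decode y))))"
  let ?end = "prod_encode (0, tape_code [None])"
  have iff: "?R\<^sup>*\<^sup>* (prod_encode (list_encode u, t)) ?end \<longleftrightarrow> t = tape_code (end_marked u)" for u t
  proof
    assume "t = tape_code (end_marked u)"
    then show "?R\<^sup>*\<^sup>* (prod_encode (list_encode u, t)) ?end"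
    proof (induction u arbitrary: t)
      case Nil
      then show ?case by (simp add: end_marked_def)
    next
      case (Cons a u)
      have "?R (prod_encode (list_encode (a # u), t))
          (prod_encode (list_encode u, tape_code (end_marked u)))"
        using Cons.prems by (simp add: end_marked_def tape_code_def)
      then show ?case using Cons.IH[OF refl] by (rule converse_rtranclp_into_rtranclp)
    qed
  next
    assume "?R\<^sup>*\<^sup>* (prod_encode (list_encode u, t)) ?end"
    then show "t = tape_code (end_marked u)"
    proof (induction u arbitrary: t)
      case Nil
      then show ?case by (cases rule: converse_rtranclpE) (auto simp: end_marked_def)
    next
      case (Cons a u)
      from Cons.prems obtain y where y: "?R (prod_encode (list_encode (a # u), t)) y" "?R\<^sup>*\<^sup>* y ?end"
        by (cases rule: converse_rtranclpE) auto
      obtain n t' where y_eq: "y = prod_encode (n, t')" by (metis prod_decode_inverse surj_pair)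
      from y(1) have n: "n = list_encode u" and t: "t = Suc (prod_encode (Suc a, t'))"
        unfolding y_eq by auto
      have "t' = tape_code (end_marked u)" using Cons.IH y(2) unfolding y_eq n .
      then show ?case unfolding t by (simp add: end_marked_def tape_code_def)
    qed
  qed
  have "t = tape_code (end_marked (list_decode x)) \<longleftrightarrow> ?R\<^sup>*\<^sup>* (prod_encode (x, t)) ?end" for x t
    using iff[of "list_decode x" t] unfolding list_decode_inverse by (rule sym)
  moreover have "semidec2 ?R"
    unfolding semidec2_def by (intro semidec_intros)
  then have "semidec (\<lambda>n. ?R\<^sup>*\<^sup>* (prod_encode (fst (prod_decode n), snd (prod_decode n))) ?end)"
    by (rule semidec2_comp[OF semidec2_rtranclp]) (intro computable_intros)+
  ultimately show ?thesis unfolding semidec2_def by (rule semidec_cong)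
qed

lemma semidec_accepting_code:
  assumes "dpda T"
  shows "semidec (\<lambda>n. \<exists>z s. dpda_accepting T m ([], z, s) \<and> n = quadruple 0 0 (list_encode (rev z)) s)"
proof -
  have fin: "finite (dpda_states T)" "finite (dpda_finals T)"
    using assms unfolding dpda_def by (auto intro: finite_subset)
  show ?thesis
  proof (cases m)
    case Final_State
    have "(\<exists>z s. dpda_accepting T m ([], z, s) \<and> n = quadruple 0 0 (list_encode (rev z)) s) \<longleftrightarrow>
        (\<exists>s\<in>dpda_finals T. \<exists>k. n = quadruple 0 0 k s)" for n
      unfolding Final_State dpda_accepting.simps by (metis list_decode_inverse rev_rev_ident)
    then show ?thesis
      by (rule semidec_cong) (intro semidec_bex fin semidec_intros computable_quadruple)
  next
    case Empty_Stack
    have "(\<exists>z s. dpda_accepting T m ([], z, s) \<and> n = quadruple 0 0 (list_encode (rev z)) s) \<longleftrightarrow>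
        (\<exists>s\<in>dpda_states T. n = quadruple 0 0 0 s)" for n
      unfolding Empty_Stack by auto
    then show ?thesis
      by (rule semidec_cong) (intro semidec_bex fin semidec_intros computable_quadruple)
  qed
qed

lemma semidec_rel_two_tape_language:
  assumes "finite A" "two_tape_language A R"
  shows "semidec_rel R"
proof -
  obtain T :: "(nat tape_letter, nat, nat) dpda" and Sh Fl m
    where T: "dpda T" and R: "R = two_tape_lang A T Sh Fl m"
    using assms(2) unfolding two_tape_language_def two_tape_def by blast
  define acc where "acc n \<longleftrightarrow>
    (\<exists>z s. dpda_accepting T m ([], z, s) \<and> n = quadruple 0 0 (list_encode (rev z)) s)" for n
  have acc: "semidec acc" unfolding acc_def using semidec_accepting_code[OF T] .
  have "(list_decode x, list_decode y) \<in> R \<longleftrightarrow> list_decode x \<in> lists A \<and> list_decode y \<in> lists A \<and>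
      (\<exists>p. \<exists>q. p = tape_code (end_marked (list_decode x)) \<and> q = tape_code (end_marked (list_decode y)) \<and>
        (\<exists>n. (coded_step T Sh Fl)\<^sup>*\<^sup>*
            (quadruple p q (list_encode [dpda_bottom T]) (dpda_start T)) n \<and> acc n))" for x y
    unfolding R two_tape_lang_def mem_Collect_eq prod.case two_tape_accepts_iff acc_def by blast
  then show ?thesis
    by (rule semidec_relI) (unfold semidec2_def, intro semidec_conj semidec_ex[unfolded semidec2_def] semidec_comp[OF acc]
        semidec_comp[OF semidec_lists[OF assms(1)]] semidec2_comp[OF semidec2_end_marked]
        semidec2_comp[OF semidec2_rtranclp[OF semidec2_coded_step[OF T]]]
        computable_quadruple computable_intros)
qed

lemma semidec_rel_ATP_language:
  assumes "finite A" "ATP_language A R"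
  shows "semidec_rel R"
proof -
  obtain F where F: "finite F" "\<And>K. K \<in> F \<Longrightarrow> semidec_rel K"
    and R: "R = (lists A \<times> lists A) \<inter> \<Inter>F"
    using assms semidec_rel_two_tape_language unfolding ATP_language_def by blast
  have "(list_decode x, list_decode y) \<in> R \<longleftrightarrow> list_decode x \<in> lists A \<and> list_decode y \<in> lists A \<and>
      (\<forall>K\<in>F. (list_decode x, list_decode y) \<in> K)" for x y
    unfolding R by blast
  then show ?thesis
    by (rule semidec_relI) (unfold semidec2_def, intro semidec_conj semidec_ball F(1) F(2)[unfolded semidec_rel_def semidec2_def]
        semidec_comp[OF semidec_lists[OF assms(1)]] computable_intros)
qed

section \<open>Words over a group\<close>

lemma word_eval_Nil [simp]: "word_eval G \<pi> [] = \<one>\<^bsub>G\<^esub>"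
  by (simp add: word_eval_def)

lemma word_eval_Cons [simp]: "word_eval G \<pi> (a # w) = \<pi> a \<otimes>\<^bsub>G\<^esub> word_eval G \<pi> w"
  by (simp add: word_eval_def)

context monoid
begin

lemma word_eval_closed:
  assumes "\<pi> \<in> A \<rightarrow> carrier G" "w \<in> lists A"
  shows "word_eval G \<pi> w \<in> carrier G"
  using assms(2) by (induction w) (use assms(1) in auto)

lemma word_eval_append:
  assumes "\<pi> \<in> A \<rightarrow> carrier G" "v \<in> lists A" "w \<in> lists A"
  shows "word_eval G \<pi> (v @ w) = word_eval G \<pi> v \<otimes> word_eval G \<pi> w"
  using assms(2)
proof (induction v)
  case Nil
  show ?case using word_eval_closed[OF assms(1,3)] by simp
next
  case (Cons a v)
  then have "\<pi> a \<in> carrier G" "word_eval G \<pi> v \<in> carrier G" "word_eval G \<pi> w \<in> carrier G"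
    using assms(1) word_eval_closed[OF assms(1)] assms(3) by auto
  then show ?case using Cons by (simp add: m_assoc)
qed

lemma word_eval_snoc:
  assumes "\<pi> \<in> A \<rightarrow> carrier G" "v \<in> lists A" "a \<in> A"
  shows "word_eval G \<pi> (v @ [a]) = word_eval G \<pi> v \<otimes> \<pi> a"
proof -
  have "\<pi> a \<in> carrier G" using assms(1,3) by (rule funcset_mem)
  then show ?thesis using word_eval_append[OF assms(1,2), of "[a]"] assms(3) by simp
qed

end

text \<open>
  If \<open>R a\<close> is multiplication by the letter \<open>a\<close>, then \<open>follow R v\<close> is
  multiplication by the word \<open>v\<close>.
\<close>

primrec follow :: "('a \<Rightarrow> ('b \<times> 'b) set) \<Rightarrow> 'a list \<Rightarrow> ('b \<times> 'b) set" where
  "follow R [] = Id"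
| "follow R (a # v) = R a O follow R v"

lemma semidec_rel_follow: "(\<And>a. a \<in> set v \<Longrightarrow> semidec_rel (R a)) \<Longrightarrow> semidec_rel (follow R v)"
  by (induction v) (auto intro: semidec_rel_Id semidec_rel_relcomp)

text \<open>
  The relations are only known on \<open>L\<close>. Surjectivity of the evaluation \<open>\<nu>\<close> provides the
  intermediate normal forms, and injectivity shows that the empty word relates a normal form only to
  itself.
\<close>

lemma (in monoid) follow_iff:
  assumes bij: "bij_betw \<nu> L (carrier G)" and \<pi>: "\<pi> \<in> A \<rightarrow> carrier G"
    and R: "\<And>a u u'. a \<in> A \<Longrightarrow> u \<in> L \<Longrightarrow> (u, u') \<in> R a \<longleftrightarrow> u' \<in> L \<and> \<nu> u' = \<nu> u \<otimes> \<pi> a"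
    and "v \<in> lists A" "u \<in> L"
  shows "(u, u') \<in> follow R v \<longleftrightarrow> u' \<in> L \<and> \<nu> u' = \<nu> u \<otimes> word_eval G \<pi> v"
proof -
  have inj: "inj_on \<nu> L" and img: "\<nu> ` L = carrier G"
    using bij unfolding bij_betw_def by (rule conjunct1, rule conjunct2)
  have closed: "\<nu> u \<in> carrier G" if "u \<in> L" for u
    unfolding img[symmetric] using that by (rule imageI)
  show ?thesis
    using assms(4,5)
  proof (induction v arbitrary: u rule: list.induct)
    case Nil
    then have "\<nu> u' = \<nu> u \<longleftrightarrow> u' = u" if "u' \<in> L" using that inj by (intro inj_on_eq_iff)
    then show ?case using Nil closed by auto
  next
    case (Cons a v)
    then have a: "a \<in> A" and v: "v \<in> lists A" by simp_all
    have car: "\<nu> u \<in> carrier G" "\<pi> a \<in> carrier G" "word_eval G \<pi> v \<in> carrier G"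
      using closed[OF Cons.prems(2)] funcset_mem[OF \<pi> a] word_eval_closed[OF \<pi> v] .
    have "\<nu> u \<otimes> \<pi> a \<in> \<nu> ` L" unfolding img using car(1,2) by (rule m_closed)
    then obtain x where x: "\<nu> u \<otimes> \<pi> a = \<nu> x" "x \<in> L" by (rule imageE)
    have "y = x" if "(u, y) \<in> R a" for y
    proof -
      have "y \<in> L \<and> \<nu> y = \<nu> x"
        using that unfolding R[OF a Cons.prems(2)] x(1) .
      then show ?thesis using inj x(2) by (elim conjE) (rule inj_onD)
    qed
    moreover have "(u, x) \<in> R a"
      unfolding R[OF a Cons.prems(2)] using x(2) x(1)[symmetric] by (rule conjI)
    ultimately have "(u, u') \<in> follow R (a # v) \<longleftrightarrow> (x, u') \<in> follow R v"
      unfolding follow.simps by (intro iffI) (elim relcompEpair, simp only:, rule relcompI)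
    also have "\<dots> \<longleftrightarrow> u' \<in> L \<and> \<nu> u' = \<nu> x \<otimes> word_eval G \<pi> v" using v x(2) by (rule Cons.IH)
    also have "\<nu> x \<otimes> word_eval G \<pi> v = \<nu> u \<otimes> word_eval G \<pi> (a # v)"
      unfolding x(1)[symmetric] word_eval_Cons using car by (rule m_assoc)
    finally show ?case .
  qed
qed

section \<open>The word problem\<close>

text \<open>
  Normal forms \<open>L\<close> with evaluation \<open>\<nu>\<close> on which right multiplication by every generator
  is semidecidable solve the word problem. States of the search consist of the word still to be read
  and the normal form of the prefix already read.
\<close>

lemma (in monoid) decidable_word_problem_if_semidec_multiplication:
  fixes B :: "nat set"
  assumes B: "finite B" and \<rho>: "\<rho> \<in> B \<rightarrow> carrier G" and bij: "bij_betw \<nu> L (carrier G)"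
    and F: "\<And>b. b \<in> B \<Longrightarrow> semidec_rel (F b)"
      "\<And>b u u'. b \<in> B \<Longrightarrow> u \<in> L \<Longrightarrow> (u, u') \<in> F b \<longleftrightarrow> u' \<in> L \<and> \<nu> u' = \<nu> u \<otimes> \<rho> b"
  shows "decidable_set (list_encode ` word_problem G B \<rho>)"
proof -
  define state where "state r u = prod_encode (list_encode r, list_encode u)" for r u
  define step where "step x y \<longleftrightarrow> (\<exists>b\<in>B. fst (prod_decode x) = Suc (prod_encode (b, fst (prod_decode y))) \<and>
    (list_decode (snd (prod_decode x)), list_decode (snd (prod_decode y))) \<in> F b)" for x y
  have step_state: "step (state r u) (state r' u') \<longleftrightarrow> (\<exists>b\<in>B. r = b # r' \<and> (u, u') \<in> F b)"
    for r u r' u'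
  proof -
    have "list_encode r = Suc (prod_encode (b, list_encode r')) \<longleftrightarrow> r = b # r'" for b
      by (metis list_encode.simps(2) list_encode_eq)
    then show ?thesis unfolding step_def state_def by simp
  qed
  have state_cases: "\<exists>r u. y = state r u" for y
    unfolding state_def by (metis list_decode_inverse prod_decode_inverse surj_pair)
  have state_inj: "state r u = state r' u' \<longleftrightarrow> r = r' \<and> u = u'" for r u r' u'
    unfolding state_def by (simp add: list_encode_eq)
  have "\<one> \<in> \<nu> ` L" using bij unfolding bij_betw_def by simp
  then obtain e where e: "e \<in> L" "\<nu> e = \<one>" by (metis imageE)
  have sound: "\<exists>p. w = p @ r \<and> p \<in> lists B \<and> u \<in> L \<and> \<nu> u = word_eval G \<rho> p"
    if "step\<^sup>*\<^sup>* (state w e) (state r u)" for w r u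
    using that
  proof (induction "state r u" arbitrary: r u rule: rtranclp_induct)
    case base
    then show ?case using e by (auto simp: state_inj intro: exI[of _ "[]"])
  next
    case (step y)
    obtain r' u' where y: "y = state r' u'" using state_cases by blast
    obtain p where p: "w = p @ r'" "p \<in> lists B" "u' \<in> L" "\<nu> u' = word_eval G \<rho> p"
      using step.hyps(3)[OF y] by blast
    obtain b where b: "b \<in> B" "r' = b # r" "(u', u) \<in> F b"
      using step.hyps(2) unfolding y step_state by blast
    have "u \<in> L \<and> \<nu> u = word_eval G \<rho> (p @ [b])"
      using F(2)[OF b(1) p(3)] b(3) p word_eval_snoc[OF \<rho> p(2) b(1)] by simp
    then show ?case using p b by (intro exI[of _ "p @ [b]"]) auto
  qed
  have complete: "\<exists>u. step\<^sup>*\<^sup>* (state (p @ r) e) (state r u)" if "p \<in> lists B" for p r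
    using that
  proof (induction p arbitrary: r rule: rev_induct)
    case Nil
    show ?case by auto
  next
    case (snoc b p)
    then have b: "b \<in> B" "p \<in> lists B" by auto
    obtain u where u: "step\<^sup>*\<^sup>* (state (p @ b # r) e) (state (b # r) u)" using snoc.IH[OF b(2)] by blast
    have "u \<in> L" using sound[OF u] by (elim exE conjE)
    moreover have "\<nu> u \<otimes> \<rho> b \<in> \<nu> ` L"
      using bij \<open>u \<in> L\<close> b(1) \<rho> unfolding bij_betw_def by (metis Pi_mem imageI m_closed)
    ultimately obtain u' where "(u, u') \<in> F b" using F(2)[OF b(1)] by (metis imageE)
    then have "step (state (b # r) u) (state r u')" unfolding step_state using b(1) by blast
    with u have "step\<^sup>*\<^sup>* (state (p @ b # r) e) (state r u')" by (rule rtranclp.rtrancl_into_rtrancl)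
    then show ?case by (intro exI) simp
  qed
  have inj: "\<nu> u = \<one> \<longleftrightarrow> u = e" if "u \<in> L" for u
    using that e bij unfolding bij_betw_def inj_on_def by metis
  \<comment> \<open>A search that has arrived in such a state shows that the word is not in the word problem.\<close>
  define stuck where "stuck y \<longleftrightarrow> (fst (prod_decode y) = 0 \<and> snd (prod_decode y) \<noteq> list_encode e) \<or>
    (\<exists>a. \<exists>r. fst (prod_decode y) = Suc (prod_encode (a, r)) \<and> (\<forall>b\<in>B. a \<noteq> b))" for y
  have stuck_state: "stuck (state r u) \<longleftrightarrow> (r = [] \<and> u \<noteq> e) \<or> (\<exists>a r'. r = a # r' \<and> a \<notin> B)" for r u
  proof (cases r)
    case Nil
    then show ?thesis by (simp add: stuck_def state_def list_encode_eq)
  next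
    case (Cons a r')
    then show ?thesis by (auto simp: stuck_def state_def)
  qed
  have yes: "w \<in> word_problem G B \<rho> \<longleftrightarrow> step\<^sup>*\<^sup>* (state w e) (state [] e)" for w
  proof
    assume "w \<in> word_problem G B \<rho>"
    then have w: "w \<in> lists B" "word_eval G \<rho> w = \<one>" unfolding word_problem_def by auto
    then obtain u where u: "step\<^sup>*\<^sup>* (state w e) (state [] u)" using complete[of w "[]"] by auto
    then have "u = e" using sound[OF u] w inj by auto
    with u show "step\<^sup>*\<^sup>* (state w e) (state [] e)" by (simp only:)
  next
    assume "step\<^sup>*\<^sup>* (state w e) (state [] e)"
    from sound[OF this] show "w \<in> word_problem G B \<rho>" using e unfolding word_problem_def by auto
  qed
  have no: "w \<notin> word_problem G B \<rho> \<longleftrightarrow> (\<exists>y. step\<^sup>*\<^sup>* (state w e) y \<and> stuck y)" for w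
  proof
    assume not: "w \<notin> word_problem G B \<rho>"
    show "\<exists>y. step\<^sup>*\<^sup>* (state w e) y \<and> stuck y"
    proof (cases "w \<in> lists B")
      case True
      then obtain u where u: "step\<^sup>*\<^sup>* (state w e) (state [] u)" using complete[of w "[]"] by auto
      then have "u \<noteq> e" using not yes by auto
      then have "stuck (state [] u)" unfolding stuck_state by simp
      then show ?thesis using u by (intro exI conjI)
    next
      case False
      then obtain p a r where w: "w = p @ a # r" and p: "p \<in> lists B" and a: "a \<notin> B"
        using split_list_first_prop[of w "\<lambda>a. a \<notin> B"] by (auto simp: in_lists_conv_set)
      obtain u where "step\<^sup>*\<^sup>* (state w e) (state (a # r) u)" using complete[OF p] w by blast
      moreover have "stuck (state (a # r) u)" unfolding stuck_state using a by simp
      ultimately show ?thesis by (intro exI conjI)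
    qed
  next
    assume "\<exists>y. step\<^sup>*\<^sup>* (state w e) y \<and> stuck y"
    then obtain r u where steps: "step\<^sup>*\<^sup>* (state w e) (state r u)" and stuck: "stuck (state r u)"
      by (metis state_cases)
    from sound[OF steps] obtain p where p: "w = p @ r" "u \<in> L" "\<nu> u = word_eval G \<rho> p" by blast
    show "w \<notin> word_problem G B \<rho>"
      using stuck inj[OF p(2)] unfolding stuck_state p(1) p(3) word_problem_def by auto
  qed
  have "semidec2 step"
    unfolding step_def semidec2_def
    by (intro semidec_bex B semidec_conj semidec_eq computable_intros
        semidec2_comp[OF F(1)[unfolded semidec_rel_def]])
  note steps = semidec2_comp[OF semidec2_rtranclp[OF this]]
  have stuck: "semidec stuck"
    unfolding stuck_def by (intro semidec_ball B semidec_intros)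
  have mem: "n \<in> list_encode ` W \<longleftrightarrow> list_decode n \<in> W" for n and W :: "nat list set"
    by (metis image_iff list_decode_inverse list_encode_inverse)
  have st: "state (list_decode n) u = prod_encode (n, list_encode u)" for n u
    by (simp add: state_def)
  show ?thesis
  proof (rule decidable_set_if_semidec)
    show "semidec (\<lambda>n. n \<in> list_encode ` word_problem G B \<rho>)"
      unfolding mem yes st by (intro steps computable_intros)
    show "semidec (\<lambda>n. n \<notin> list_encode ` word_problem G B \<rho>)"
      unfolding mem no st
      by (intro semidec_ex[unfolded semidec2_def] semidec_conj steps semidec_comp[OF stuck]
          computable_intros)
  qed
qed

theorem theorem4p2:
  fixes G :: "('g, 'm) monoid_scheme"
  assumes "P_group G"
  shows "solvable_word_problem G"
proof -
  obtain A :: "nat set" and \<pi> L where "group G" and gen: "generating_alphabet G A \<pi>"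
    and P: "P_structure G A \<pi> L"
    using assms unfolding P_group_def by blast
  interpret group G by fact
  from gen have A: "finite A" and \<pi>: "\<pi> \<in> A \<rightarrow> carrier G"
    and surj: "word_eval G \<pi> ` lists A = carrier G"
    unfolding generating_alphabet_def by auto
  from P have L: "L \<subseteq> lists A" and bij: "bij_betw (word_eval G \<pi>) L (carrier G)"
    unfolding P_structure_def by auto
  define R where "R a = {(w, w'). w \<in> L \<and> w' \<in> L \<and> word_eval G \<pi> w' = word_eval G \<pi> (w @ [a])}" for a
  have semidec: "semidec_rel (R a)" if "a \<in> A" for a
    using P that semidec_rel_ATP_language[OF A] unfolding P_structure_def R_def by blast
  have R: "(u, u') \<in> R a \<longleftrightarrow> u' \<in> L \<and> word_eval G \<pi> u' = word_eval G \<pi> u \<otimes>\<^bsub>G\<^esub> \<pi> a"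
    if "a \<in> A" "u \<in> L" for a u u'
  proof -
    have "word_eval G \<pi> (u @ [a]) = word_eval G \<pi> u \<otimes>\<^bsub>G\<^esub> \<pi> a"
      using L that word_eval_snoc[OF \<pi>] by blast
    then show ?thesis using that(2) unfolding R_def by auto
  qed
  have "decidable_set (list_encode ` word_problem G B \<rho>)" if "generating_alphabet G B \<rho>"
    for B :: "nat set" and \<rho>
  proof -
    from that have B: "finite B" and \<rho>: "\<rho> \<in> B \<rightarrow> carrier G"
      unfolding generating_alphabet_def by auto
    have "\<exists>v \<in> lists A. word_eval G \<pi> v = \<rho> b" if "b \<in> B" for b
      using \<rho> that surj by (metis Pi_mem imageE)
    then obtain v where v: "\<And>b. b \<in> B \<Longrightarrow> v b \<in> lists A" "\<And>b. b \<in> B \<Longrightarrow> word_eval G \<pi> (v b) = \<rho> b"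
      by metis
    show ?thesis
    proof (rule decidable_word_problem_if_semidec_multiplication[OF B \<rho> bij])
      show "semidec_rel (follow R (v b))" if "b \<in> B" for b
        using v(1)[OF that] by (intro semidec_rel_follow semidec) auto
      show "(u, u') \<in> follow R (v b) \<longleftrightarrow> u' \<in> L \<and> word_eval G \<pi> u' = word_eval G \<pi> u \<otimes>\<^bsub>G\<^esub> \<rho> b"
        if "b \<in> B" "u \<in> L" for b u u'
        using follow_iff[OF bij \<pi> R v(1)[OF that(1)] that(2)] v(2)[OF that(1)] by simp
    qed
  qed
  moreover have "\<exists>(A :: nat set) \<pi>. generating_alphabet G A \<pi>" using gen by (intro exI)
  ultimately show ?thesis unfolding solvable_word_problem_def by (intro conjI allI impI)
qed

end
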